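(* We have $$\Phi\bigl(\mathrm{SL}^2(\mathcal{S}^n_+)\bigr)=P_{n,4},$$ and moreover the same equality holds if $\mathrm{SL}^2(\mathcal{S}^n_+)$ is replaced by the set of nondegenerate quadratic forms in $\mathrm{SL}^2(\mathcal{S}^n_+)$.
   Context: $\mathcal{S}^n$ is the vector space of real symmetric $n\times n$ matrices with inner product $\langle A,B\rangle=\operatorname{trace}(AB)$, and $\mathcal{S}^n_+\subset\mathcal{S}^n$ is the cone of positive semidefinite matrices. A quadratic form $q$ on $\mathcal{S}^n$ has an associated symmetric bilinear form $B$ with $q(X)=B(X,X)$, represented in an orthonormal basis by a symmetric matrix $Q$; $q$ is nondegenerate if $Q$ is nonsingular. The form $q$ is $\mathcal{S}^n_+$-Lorentzian if $Q$ has exactly one positive eigenvalue and $B(X,Y)>0$ for all $X,Y$ in the interior of $\mathcal{S}^n_+$. $\mathrm{SL}^2(\mathcal{S}^n_+)$ is the set of $\mathcal{S}^n_+$-Lorentzian quadratic forms on $\mathcal{S}^n$. $\Phi$ is the linear map from the vector space of quadratic forms on $\mathcal{S}^n$ to the vector space of real quartic forms in $x=(x_1,\dots,x_n)$ given by $\Phi(q)(x)=q(xx^t)$. $P_{n,4}$ is the cone of real quartic forms in $n$ variables that are nonnegative on $\mathbb{R}^n$.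
   Formalization: The formal theorem assumes n ≥ 2; for n = 1 the equality fails, since Lorentzian forms on S^1 are aX^2 with a > 0 and so the zero quartic in P_{1,4} is not in the image. *)

theory Defs
  imports "HOL-Analysis.Analysis" "Jordan_Normal_Form.Char_Poly"
begin

no_notation Matrix.vec_index (infixl \<open>$\<close> 100)
no_notation Matrix.scalar_prod (infix \<open>\<bullet>\<close> 70)

section \<open>The Euclidean space of real symmetric matrices\<close>

typedef 'n symmat = "{A :: real^'n^'n. Finite_Cartesian_Product.transpose A = A}"
  morphisms mat_of Symmat
proof
  show "0 \<in> {A :: real^'n^'n. Finite_Cartesian_Product.transpose A = A}"
    by (simp add: Finite_Cartesian_Product.transpose_def Finite_Cartesian_Product.vec_eq_iff)
qed

lemma mat_of_sym: "mat_of A $ i $ j = mat_of A $ j $ i"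
proof -
  have "Finite_Cartesian_Product.transpose (mat_of A) = mat_of A"
    using mat_of[of A] by simp
  then have "Finite_Cartesian_Product.transpose (mat_of A) $ j $ i = mat_of A $ j $ i" by simp
  then show ?thesis by (simp add: Finite_Cartesian_Product.transpose_def)
qed

lemma mat_of_Symmat:
  assumes "\<And>i j. M $ i $ j = M $ j $ i"
  shows "mat_of (Symmat M) = M"
  using assms by (intro Symmat_inverse) (simp add: Finite_Cartesian_Product.transpose_def Finite_Cartesian_Product.vec_eq_iff)

lemma symmat_eqI: "mat_of A = mat_of B \<Longrightarrow> A = B"
  by (simp add: mat_of_inject)

instantiation symmat :: (finite) real_vector
begin

definition "0 = Symmat 0"
definition "A + B = Symmat (mat_of A + mat_of B)"
definition "A - B = Symmat (mat_of A - mat_of B)"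
definition "- A = Symmat (- mat_of A)"
definition "c *\<^sub>R A = Symmat (c *\<^sub>R mat_of A)"

lemma mat_of_zero [simp]: "mat_of 0 = 0"
  unfolding zero_symmat_def by (rule mat_of_Symmat) simp

lemma mat_of_add [simp]: "mat_of (A + B) = mat_of A + mat_of B"
  unfolding plus_symmat_def by (rule mat_of_Symmat) (simp, metis mat_of_sym)

lemma mat_of_diff [simp]: "mat_of (A - B) = mat_of A - mat_of B"
  unfolding minus_symmat_def by (rule mat_of_Symmat) (simp, metis mat_of_sym)

lemma mat_of_uminus [simp]: "mat_of (- A) = - mat_of A"
  unfolding uminus_symmat_def by (rule mat_of_Symmat) (simp, metis mat_of_sym)

lemma mat_of_scaleR [simp]: "mat_of (c *\<^sub>R A) = c *\<^sub>R mat_of A"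
  unfolding scaleR_symmat_def by (rule mat_of_Symmat) (simp, metis mat_of_sym)

instance
  by standard (rule symmat_eqI, simp add: algebra_simps)+

end

lemma trace_mult_mat_of:
  "trace (mat_of A ** mat_of B) = inner (mat_of A) (mat_of B)"
proof -
  have "trace (mat_of A ** mat_of B) = (\<Sum>i\<in>UNIV. \<Sum>k\<in>UNIV. mat_of A $ i $ k * mat_of B $ k $ i)"
    by (simp add: trace_def matrix_matrix_mult_def)
  also have "\<dots> = (\<Sum>i\<in>UNIV. \<Sum>k\<in>UNIV. mat_of A $ i $ k * mat_of B $ i $ k)"
    by (intro sum.cong refl arg_cong2[where f="(*)"] mat_of_sym)
  finally show ?thesis by (simp add: inner_vec_def)
qed

instantiation symmat :: (finite) real_inner
begin

definition inner_symmat_def: "inner (A :: 'a symmat) B = trace (mat_of A ** mat_of B)"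
definition norm_symmat_def: "norm (A :: 'a symmat) = sqrt (inner A A)"
definition sgn_symmat_def: "sgn (A :: 'a symmat) = inverse (norm A) *\<^sub>R A"
definition dist_symmat_def: "dist (A :: 'a symmat) B = norm (A - B)"
definition uniformity_symmat_def:
  "(uniformity :: ('a symmat \<times> 'a symmat) filter) =
     (INF e\<in>{0 <..}. principal {(A, B). dist A B < e})"
definition open_symmat_def:
  "open (U :: 'a symmat set) \<longleftrightarrow> (\<forall>A\<in>U. eventually (\<lambda>(A', B). A' = A \<longrightarrow> B \<in> U) uniformity)"

lemma inner_mat_of: "inner A B = inner (mat_of A) (mat_of B)"
  by (simp add: inner_symmat_def trace_mult_mat_of)

instance
proof
  fix A B C :: "'a symmat" and r :: real
  show "dist A B = norm (A - B)" by (rule dist_symmat_def)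
  show "sgn A = A /\<^sub>R norm A" by (rule sgn_symmat_def)
  show "uniformity = (INF e\<in>{0 <..}. principal {(A, B :: 'a symmat). dist A B < e})"
    by (rule uniformity_symmat_def)
  show "open U \<longleftrightarrow> (\<forall>A\<in>U. eventually (\<lambda>(A', B). A' = A \<longrightarrow> B \<in> U) uniformity)"
    for U :: "'a symmat set" by (rule open_symmat_def)
  show "inner A B = inner B A" by (simp add: inner_mat_of inner_commute)
  show "inner (A + B) C = inner A C + inner B C" by (simp add: inner_mat_of inner_add_left)
  show "inner (r *\<^sub>R A) B = r * inner A B" by (simp add: inner_mat_of)
  show "0 \<le> inner A A" by (simp add: inner_mat_of)
  show "inner A A = 0 \<longleftrightarrow> A = 0"
    by (metis inner_mat_of inner_eq_zero_iff mat_of_zero symmat_eqI)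
  show "norm A = sqrt (inner A A)" by (rule norm_symmat_def)
qed

end

lemma orthonormal_basis_symmat_exists:
  "\<exists>\<B> :: 'n::finite symmat set. \<B> \<noteq> {} \<and> finite \<B> \<and>
     (\<forall>U\<in>\<B>. \<forall>V\<in>\<B>. inner U V = (if U = V then 1 else 0)) \<and>
     (\<forall>A. (\<forall>U\<in>\<B>. inner A U = 0) \<longleftrightarrow> A = 0)"
proof -
  let ?S = "range mat_of :: (real^'n^'n) set"
  have sub: "subspace ?S"
    unfolding subspace_def
    by (auto simp flip: mat_of_add mat_of_scaleR mat_of_zero)
  obtain C where C: "C \<subseteq> ?S" "pairwise Linear_Algebra.orthogonal C" "\<And>x. x \<in> C \<Longrightarrow> norm x = 1"
      "independent C" "span C = ?S"
    using orthonormal_basis_subspace[OF sub] by metis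
  have finC: "finite C" using C(4) by (rule independent_imp_finite)
  define \<B> where "\<B> = (mat_of :: 'n symmat \<Rightarrow> _) -` C"
  have img: "mat_of ` \<B> = C" using C(1) unfolding \<B>_def by blast
  have inj: "inj (mat_of :: 'n symmat \<Rightarrow> _)" by (simp add: inj_on_def mat_of_inject)
  have fin: "finite \<B>" unfolding \<B>_def using finC inj by (rule finite_vimageI)
  have on: "inner U V = (if U = V then 1 else 0)" if "U \<in> \<B>" "V \<in> \<B>" for U V
  proof (cases "U = V")
    case True
    then show ?thesis using that C(3) by (simp add: \<B>_def inner_mat_of norm_eq_1)
  next
    case False
    then have "mat_of U \<noteq> mat_of V" by (simp add: mat_of_inject)
    then show ?thesis using that C(2) False
      by (simp add: \<B>_def inner_mat_of pairwise_def Linear_Algebra.orthogonal_def)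
  qed
  have zero: "A = 0" if "\<forall>U\<in>\<B>. inner A U = 0" for A
  proof -
    have "\<forall>c\<in>C. Linear_Algebra.orthogonal (mat_of A) c"
      using that img by (auto simp: inner_mat_of Linear_Algebra.orthogonal_def)
    moreover have "mat_of A \<in> span C" using C(5) by simp
    ultimately have "Linear_Algebra.orthogonal (mat_of A) (mat_of A)"
      using orthogonal_to_span by blast
    then show ?thesis by (intro symmat_eqI) (simp add: orthogonal_self)
  qed
  have ne: "\<B> \<noteq> {}"
  proof
    assume "\<B> = {}"
    then have "Symmat (Finite_Cartesian_Product.mat 1) = (0 :: 'n symmat)" using zero by blast
    moreover have "mat_of (Symmat (Finite_Cartesian_Product.mat 1)) = (Finite_Cartesian_Product.mat 1 :: real^'n^'n)"
      by (rule mat_of_Symmat) (simp add: Finite_Cartesian_Product.mat_def)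
    ultimately have "(Finite_Cartesian_Product.mat 1 :: real^'n^'n) = 0" by simp
    then have "(Finite_Cartesian_Product.mat 1 :: real^'n^'n) $ undefined $ undefined = 0" by simp
    then show False by (simp add: Finite_Cartesian_Product.mat_def)
  qed
  show ?thesis
  proof (intro exI[of _ \<B>] conjI ballI allI iffI)
    show "inner U V = (if U = V then 1 else 0)" if "U \<in> \<B>" "V \<in> \<B>" for U V
      using that by (rule on)
    show "A = 0" if "\<forall>U\<in>\<B>. inner A U = 0" for A using that by (rule zero)
    show "inner A U = 0" if "A = 0" for A U using that by simp
  qed (fact ne fin)+
qed

instantiation symmat :: (finite) euclidean_space
begin

definition Basis_symmat_def:
  "(Basis :: 'a symmat set) = (SOME \<B>. \<B> \<noteq> {} \<and> finite \<B> \<and>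
     (\<forall>U\<in>\<B>. \<forall>V\<in>\<B>. inner U V = (if U = V then 1 else 0)) \<and>
     (\<forall>A. (\<forall>U\<in>\<B>. inner A U = 0) \<longleftrightarrow> A = 0))"

instance
proof -
  have *: "(Basis :: 'a symmat set) \<noteq> {} \<and> finite (Basis :: 'a symmat set) \<and>
     (\<forall>U\<in>(Basis :: 'a symmat set). \<forall>V\<in>Basis. inner U V = (if U = V then 1 else 0)) \<and>
     (\<forall>A :: 'a symmat. (\<forall>U\<in>Basis. inner A U = 0) \<longleftrightarrow> A = 0)"
    unfolding Basis_symmat_def by (rule someI_ex[OF orthonormal_basis_symmat_exists])
  show "OFCLASS('a symmat, euclidean_space_class)"
  proof
    show "(Basis :: 'a symmat set) \<noteq> {}" using * by (rule conjunct1)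
    show "finite (Basis :: 'a symmat set)" using * by (elim conjE)
    show "inner U V = (if U = V then 1 else 0)" if "U \<in> Basis" "V \<in> Basis" for U V :: "'a symmat"
      using *[THEN conjunct2, THEN conjunct2, THEN conjunct1] that by simp
    show "(\<forall>U\<in>Basis. inner A U = 0) \<longleftrightarrow> A = 0" for A :: "'a symmat"
      by (rule *[THEN conjunct2, THEN conjunct2, THEN conjunct2, THEN spec])
  qed
qed

end

definition psd_cone :: "'n::finite symmat set" where
  "psd_cone = {A. \<forall>v :: real^'n. 0 \<le> inner v (mat_of A *v v)}"

section \<open>Quadratic forms\<close>

definition polar_form :: "('a::real_vector \<Rightarrow> real) \<Rightarrow> ('a \<Rightarrow> 'a \<Rightarrow> real) \<Rightarrow> bool" where
  "polar_form q B \<longleftrightarrow> bilinear B \<and> (\<forall>X Y. B X Y = B Y X) \<and> (\<forall>X. q X = B X X)"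

definition quadratic_form :: "('a::real_vector \<Rightarrow> real) \<Rightarrow> bool" where
  "quadratic_form q \<longleftrightarrow> (\<exists>B. polar_form q B)"

lemma polar_form_unique:
  assumes "polar_form q B"
  shows "B X Y = (q (X + Y) - q X - q Y) / 2"
proof -
  have b: "bilinear B" and s: "B X Y = B Y X" and q: "\<And>X. q X = B X X"
    using assms by (auto simp: polar_form_def)
  show ?thesis unfolding q by (simp add: bilinear_ladd[OF b] bilinear_radd[OF b] s)
qed

definition orthonormal_basis :: "'a::real_inner list \<Rightarrow> bool" where
  "orthonormal_basis E \<longleftrightarrow> span (set E) = UNIV \<and>
     (\<forall>i<length E. \<forall>j<length E. inner (E ! i) (E ! j) = (if i = j then 1 else 0))"

definition gram_matrix :: "('a \<Rightarrow> 'a \<Rightarrow> real) \<Rightarrow> 'a list \<Rightarrow> real Matrix.mat" where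
  "gram_matrix B E = Matrix.mat (length E) (length E) (\<lambda>(i, j). B (E ! i) (E ! j))"

text \<open>The eigenvalues of \<open>Q\<close> are counted with algebraic multiplicity. The conditions below do not
  depend on the orthonormal basis (see \<open>char_poly_gram_matrix\<close> and \<open>det_gram_matrix\<close>).\<close>

definition one_positive_eigenvalue :: "real Matrix.mat \<Rightarrow> bool" where
  "one_positive_eigenvalue Q \<longleftrightarrow> size (filter_mset (\<lambda>e. e > 0) (proots (char_poly Q))) = 1"

definition nondegenerate :: "('a::real_inner \<Rightarrow> real) \<Rightarrow> bool" where
  "nondegenerate q \<longleftrightarrow>
     (\<exists>B E. polar_form q B \<and> orthonormal_basis E \<and> Determinant.det (gram_matrix B E) \<noteq> 0)"

definition lorentzian :: "'a::real_inner set \<Rightarrow> ('a \<Rightarrow> real) \<Rightarrow> bool" where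
  "lorentzian K q \<longleftrightarrow>
     (\<exists>B E. polar_form q B \<and> orthonormal_basis E \<and> one_positive_eigenvalue (gram_matrix B E) \<and>
        (\<forall>X\<in>interior K. \<forall>Y\<in>interior K. B X Y > 0))"

definition SL2 :: "'a::real_inner set \<Rightarrow> ('a \<Rightarrow> real) set" where
  "SL2 K = {q. quadratic_form q \<and> lorentzian K q}"

lemma orthonormal_basis_distinct:
  assumes "orthonormal_basis E" shows "distinct E"
  unfolding distinct_conv_nth
proof (intro allI impI)
  fix i j assume ij: "i < length E" "j < length E" "i \<noteq> j"
  then have "inner (E ! i) (E ! j) = 0" "inner (E ! i) (E ! i) = 1"
    using assms by (auto simp: orthonormal_basis_def)
  then show "E ! i \<noteq> E ! j" by auto
qed

lemma orthonormal_basis_expansion: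
  assumes E: "orthonormal_basis E"
  shows "X = (\<Sum>k<length E. inner X (E ! k) *\<^sub>R E ! k)"
proof -
  define D where "D = X - (\<Sum>k<length E. inner X (E ! k) *\<^sub>R E ! k)"
  have "inner D y = 0" if y: "y \<in> set E" for y
  proof -
    obtain i where i: "i < length E" "E ! i = y" using y by (auto simp: in_set_conv_nth)
    have "inner (\<Sum>k<length E. inner X (E ! k) *\<^sub>R E ! k) (E ! i)
        = (\<Sum>k<length E. inner X (E ! k) * (if k = i then 1 else 0))"
      using E i(1) by (simp add: inner_sum_left orthonormal_basis_def)
    also have "\<dots> = inner X (E ! i)" using i by (simp add: if_distrib sum.delta cong: if_cong)
    finally show ?thesis by (simp add: D_def inner_diff_left i(2)[symmetric])
  qed
  then have "Linear_Algebra.orthogonal D D"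
    using E by (intro orthogonal_to_span[of D "set E"]) (auto simp: orthonormal_basis_def Linear_Algebra.orthogonal_def)
  then show ?thesis by (simp add: D_def orthogonal_self)
qed

lemma orthonormal_basis_length:
  assumes "orthonormal_basis (E :: 'a::euclidean_space list)"
  shows "length E = DIM('a)"
proof -
  have on: "inner (E ! i) (E ! j) = (if i = j then 1 else 0)"
    if "i < length E" "j < length E" for i j
    using assms that by (simp add: orthonormal_basis_def)
  have "pairwise Linear_Algebra.orthogonal (set E)"
    unfolding pairwise_def Linear_Algebra.orthogonal_def by (auto simp: in_set_conv_nth on)
  moreover have "0 \<notin> set E"
  proof
    assume "0 \<in> set E"
    then obtain i where "i < length E" "E ! i = 0" by (auto simp: in_set_conv_nth)
    then show False using on[of i i] by simp
  qed
  ultimately have "independent (set E)" by (rule pairwise_orthogonal_independent)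
  then have "card (set E) = dim (span (set E))"
    by (simp add: dim_eq_card_independent)
  also have "span (set E) = UNIV" using assms by (simp add: orthonormal_basis_def)
  finally show ?thesis
    using orthonormal_basis_distinct[OF assms] by (simp add: distinct_card)
qed

lemma similar_gram_matrix:
  assumes B: "bilinear B"
    and E: "orthonormal_basis (E :: 'a::euclidean_space list)" and F: "orthonormal_basis F"
  shows "similar_mat (gram_matrix B E) (gram_matrix B F)"
proof -
  define N where "N = length E"
  have lF: "length F = N" using E F by (simp add: N_def orthonormal_basis_length)
  define P where "P = Matrix.mat N N (\<lambda>(i, j). inner (E ! i) (F ! j))"
  define P' where "P' = Matrix.mat N N (\<lambda>(i, j). inner (F ! i) (E ! j))"
  have [simp]: "P \<in> carrier_mat N N" "P' \<in> carrier_mat N N" by (simp_all add: P_def P'_def)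
  have one: "(\<Sum>k<N. inner (G ! i) (H ! k) * inner (H ! k) (G ! j)) = (if i = j then 1 else 0)"
    if G: "orthonormal_basis G" "length G = N" and H: "orthonormal_basis H" "length H = N"
      and ij: "i < N" "j < N" for G H :: "'a list" and i j
  proof -
    have "inner (G ! i) (G ! j) = inner (\<Sum>k<length H. inner (G ! i) (H ! k) *\<^sub>R H ! k) (G ! j)"
      using orthonormal_basis_expansion[OF H(1), of "G ! i"] by simp
    then show ?thesis using G H ij by (simp add: inner_sum_left orthonormal_basis_def)
  qed
  have PP': "P * P' = 1\<^sub>m N"
    using one[OF E _ F lF] by (intro eq_matI)
      (auto simp: P_def P'_def N_def[symmetric] scalar_prod_def lessThan_atLeast0)
  have P'P: "P' * P = 1\<^sub>m N"
    using one[OF F lF E] by (intro eq_matI)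
      (auto simp: P_def P'_def N_def[symmetric] scalar_prod_def lessThan_atLeast0)
  have eq: "gram_matrix B E = P * gram_matrix B F * P'"
  proof (rule eq_matI)
    fix i j assume "i < dim_row (P * gram_matrix B F * P')" "j < dim_col (P * gram_matrix B F * P')"
    then have ij: "i < N" "j < N" by (auto simp: P_def P'_def)
    have lin: "linear (\<lambda>x. B x y)" "linear (B x)" for x y
      using B by (auto simp: bilinear_def)
    have "B (E ! i) (E ! j) = B (E ! i) (\<Sum>l<N. inner (E ! j) (F ! l) *\<^sub>R F ! l)"
      using orthonormal_basis_expansion[OF F, of "E ! j"] lF by simp
    also have "\<dots> = (\<Sum>l<N. inner (E ! j) (F ! l) * B (E ! i) (F ! l))"
      by (simp add: linear_sum[OF lin(2)] linear_cmul[OF lin(2)])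
    also have "\<dots> = (\<Sum>l<N. inner (E ! j) (F ! l) * (\<Sum>k<N. inner (E ! i) (F ! k) * B (F ! k) (F ! l)))"
    proof (rule sum.cong[OF refl])
      fix l
      have "B (E ! i) (F ! l) = B (\<Sum>k<N. inner (E ! i) (F ! k) *\<^sub>R F ! k) (F ! l)"
        using orthonormal_basis_expansion[OF F, of "E ! i"] lF by simp
      then show "inner (E ! j) (F ! l) * B (E ! i) (F ! l) =
          inner (E ! j) (F ! l) * (\<Sum>k<N. inner (E ! i) (F ! k) * B (F ! k) (F ! l))"
        by (simp add: linear_sum[OF lin(1)] linear_cmul[OF lin(1)])
    qed
    finally have *: "B (E ! i) (E ! j) =
        (\<Sum>l<N. (\<Sum>k<N. inner (E ! i) (F ! k) * B (F ! k) (F ! l)) * inner (F ! l) (E ! j))"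
      by (simp add: inner_commute mult.commute)
    show "gram_matrix B E $$ (i, j) = (P * gram_matrix B F * P') $$ (i, j)"
      using ij * by (simp add: gram_matrix_def P_def P'_def N_def[symmetric] lF
          Matrix.scalar_prod_def lessThan_atLeast0)
  qed (simp_all add: gram_matrix_def P_def P'_def N_def)
  have "gram_matrix B E \<in> carrier_mat N N" "gram_matrix B F \<in> carrier_mat N N"
    by (simp_all add: gram_matrix_def N_def[symmetric] lF)
  with PP' P'P eq have "similar_mat_wit (gram_matrix B E) (gram_matrix B F) P P'"
    by (rule similar_mat_witI) simp_all
  then show ?thesis unfolding similar_mat_def by blast
qed

lemma char_poly_gram_matrix:
  assumes "bilinear B" "orthonormal_basis (E :: 'a::euclidean_space list)" "orthonormal_basis F"
  shows "char_poly (gram_matrix B E) = char_poly (gram_matrix B F)"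
  using similar_gram_matrix[OF assms] by (rule char_poly_similar)

lemma det_gram_matrix:
  assumes "bilinear B" "orthonormal_basis (E :: 'a::euclidean_space list)" "orthonormal_basis F"
  shows "Determinant.det (gram_matrix B E) = Determinant.det (gram_matrix B F)"
  using similar_gram_matrix[OF assms] by (rule det_similar)

section \<open>Quartic forms\<close>

definition quartic_form :: "(real^'n::finite \<Rightarrow> real) \<Rightarrow> bool" where
  "quartic_form p \<longleftrightarrow>
     (\<exists>c. \<forall>x. p x = (\<Sum>i\<in>UNIV. \<Sum>j\<in>UNIV. \<Sum>k\<in>UNIV. \<Sum>l\<in>UNIV.
        c i j k l * x $ i * x $ j * x $ k * x $ l))"

definition nonneg_quartics :: "(real^'n::finite \<Rightarrow> real) set" where
  "nonneg_quartics = {p. quartic_form p \<and> (\<forall>x. 0 \<le> p x)}"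

text \<open>The rank-one symmetric matrix \<open>xx\<^sup>t\<close>.\<close>
definition rank_one :: "real^'n::finite \<Rightarrow> 'n symmat" where
  "rank_one x = Symmat (\<chi> i j. x $ i * x $ j)"

definition Phi :: "('n::finite symmat \<Rightarrow> real) \<Rightarrow> (real^'n \<Rightarrow> real)" where
  "Phi q = (\<lambda>x. q (rank_one x))"

lemma mat_of_rank_one: "mat_of (rank_one x) $ i $ j = x $ i * x $ j"
  unfolding rank_one_def by (subst mat_of_Symmat) (simp_all add: mult.commute)

end

theory Submission
  imports Defs
begin

text \<open>Forms in the Lorentzian class are positive on the interior of the semidefinite cone, hence
  nonnegative on its boundary and in particular at every \<open>xx\<^sup>t\<close>. The converse inclusion is the point.

  Let \<open>p\<close> be a nonnegative quartic and \<open>q\<^sub>0\<close> any quadratic form with \<open>q\<^sub>0(xx\<^sup>t) = p(x)\<close>. The form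
  \<open>m(X) = (tr X)\<^sup>2 - |X|\<^sup>2\<close> vanishes at all \<open>xx\<^sup>t\<close>, is positive at the identity because \<open>n \<ge> 2\<close>, and
  is negative definite on traceless matrices. So \<open>q = q\<^sub>0 + t m\<close> still maps to \<open>p\<close>, and for large
  \<open>t\<close> it inherits the signature of \<open>m\<close>: one positive eigenvalue, all others negative. This is read
  off from an orthonormal basis that diagonalizes the polar form
  (\<open>lorentzian_signature_if_negative_on_hyperplane\<close>).

  Positivity of the polar form \<open>B\<close> on the interior is not a perturbation statement: the polar form
  of \<open>m\<close> vanishes at the boundary pairs \<open>(xx\<^sup>t, xx\<^sup>t)\<close>. Every positive semidefinite matrix is a sum
  of matrices \<open>xx\<^sup>t\<close> (\<open>psd_cone_linear_nonneg\<close>), so it is enough to have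
  \<open>B(xx\<^sup>t, yy\<^sup>t) \<ge> 0\<close> for unit vectors. There the polar form of \<open>m\<close> is \<open>1 - \<langle>x, y\<rangle>\<^sup>2\<close>, and
  nonnegativity of \<open>p\<close> at \<open>x + y\<close> and \<open>x - y\<close> bounds the polar form of \<open>q\<^sub>0\<close> from below by a
  multiple of \<open>-(1 - \<langle>x, y\<rangle>\<^sup>2)\<close> (\<open>rank_one_pair_lower_bound\<close>). Subtracting small multiples of the
  identity from two interior points then makes the inequality strict.\<close>

section \<open>Diagonalizing a symmetric bilinear form\<close>

text \<open>A maximum point \<open>x\<close> of \<open>B(x, x)\<close> on the unit sphere of \<open>S\<close> splits off: \<open>2B(x, y)\<close> is the
  derivative of \<open>B(z, z)\<close> at \<open>x\<close> along the sphere in a direction \<open>y\<close> orthogonal to \<open>x\<close>, so it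
  vanishes, and the orthogonal complement of \<open>x\<close> in \<open>S\<close> is handled by induction.\<close>

lemma ex_orthonormal_diagonalizing_set:
  fixes B :: "'a::euclidean_space \<Rightarrow> 'a \<Rightarrow> real"
  assumes B: "bilinear B" and sym: "\<And>x y. B x y = B y x"
  shows "subspace S \<Longrightarrow> \<exists>F. finite F \<and> span F = S \<and>
    (\<forall>u\<in>F. \<forall>v\<in>F. inner u v = (if u = v then 1 else 0)) \<and>
    (\<forall>u\<in>F. \<forall>v\<in>F. u \<noteq> v \<longrightarrow> B u v = 0)"
proof (induction "dim S" arbitrary: S rule: less_induct)
  case less
  note S = \<open>subspace S\<close>
  note B_simps = bilinear_ladd[OF B] bilinear_radd[OF B] bilinear_lmul[OF B] bilinear_rmul[OF B]
  show ?case
  proof (cases "S = {0}")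
    case True
    then show ?thesis by (intro exI[of _ "{}"]) simp
  next
    case False
    define m where "m z = B z z" for z
    obtain z0 where z0: "z0 \<in> S" "z0 \<noteq> 0" using S False subspace_0 by blast
    have "z0 /\<^sub>R norm z0 \<in> S \<inter> sphere 0 1" using z0 S by (simp add: subspace_scale)
    then have ne: "S \<inter> sphere 0 1 \<noteq> {}" by blast
    have "compact (S \<inter> sphere 0 1)"
      using S by (simp add: closed_Int_compact closed_subspace)
    moreover have "continuous_on (S \<inter> sphere 0 1) m"
      unfolding m_def by (intro bilinear_continuous_on_compose[OF _ _ B] continuous_on_id)
    ultimately obtain x where x: "x \<in> S" "norm x = 1"
      and max1: "\<And>z. z \<in> S \<Longrightarrow> norm z = 1 \<Longrightarrow> m z \<le> m x"
      using continuous_attains_sup[OF _ ne, of m] by auto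
    have xx: "inner x x = 1" using x(2) by (simp add: norm_eq_1)
    have max: "m z \<le> m x * inner z z" if z: "z \<in> S" for z
    proof (cases "z = 0")
      case True
      then show ?thesis by (simp add: m_def bilinear_lzero[OF B])
    next
      case False
      then have "m (z /\<^sub>R norm z) \<le> m x" using z S by (intro max1) (simp_all add: subspace_scale)
      then show ?thesis using False
        by (simp add: m_def B_simps field_simps flip: power2_norm_eq_inner power2_eq_square)
    qed
    have crit: "B x y = 0" if y: "y \<in> S" "inner x y = 0" for y
    proof (rule ccontr)
      assume nz: "B x y \<noteq> 0"
      define k where "k = m x * inner y y - m y"
      have k: "k \<ge> 0" using max[OF y(1)] by (simp add: k_def)
      \<comment> \<open>Maximality along \<open>x + s y\<close> reads \<open>2s B(x, y) \<le> k s\<^sup>2\<close>, which fails for small \<open>s\<close> of the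
        sign of \<open>B(x, y)\<close>; the denominator makes this \<open>s\<close> small enough.\<close>
      define s where "s = B x y / (k + 1)"
      have "m (x + s *\<^sub>R y) \<le> m x * inner (x + s *\<^sub>R y) (x + s *\<^sub>R y)"
        using x y S by (intro max) (simp add: subspace_add subspace_scale)
      then have "2 * s * B x y \<le> s\<^sup>2 * k"
        using y(2) xx sym[of y x] inner_commute[of y x]
        by (simp add: m_def k_def B_simps algebra_simps inner_simps power2_eq_square)
      moreover have s: "s * (k + 1) = B x y" using k by (simp add: s_def)
      ultimately have "s\<^sup>2 * (k + 2) \<le> 0"
        unfolding s[symmetric] by (simp add: power2_eq_square algebra_simps)
      moreover have "s \<noteq> 0" using s nz by auto
      then have "s\<^sup>2 * (k + 2) > 0" using k by (intro mult_pos_pos) auto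
      ultimately show False by simp
    qed
    define T where "T = S \<inter> {y. inner x y = 0}"
    have T: "subspace T" unfolding T_def using S by (intro subspace_inter subspace_hyperplane)
    have "x \<notin> T" "T \<subseteq> S" using xx by (auto simp: T_def)
    then have "T \<subset> S" using x by blast
    then have "dim T < dim S" using S T by (metis dim_psubset span_eq_iff)
    then obtain F where F: "finite F" "span F = T"
        "\<forall>u\<in>F. \<forall>v\<in>F. inner u v = (if u = v then 1 else 0)"
        "\<forall>u\<in>F. \<forall>v\<in>F. u \<noteq> v \<longrightarrow> B u v = 0"
      using less.hyps[OF _ T] by auto
    have FT: "y \<in> S \<and> inner x y = 0 \<and> inner y x = 0 \<and> B x y = 0 \<and> B y x = 0" if "y \<in> F" for y
    proof -
      have "y \<in> T" using that F(2) span_superset[of F] by blast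
      then show ?thesis using crit[of y] sym[of y x] inner_commute[of y x] by (simp add: T_def)
    qed
    have "span (insert x F) = S"
    proof
      show "span (insert x F) \<subseteq> S" using x FT S by (intro span_minimal) auto
      show "S \<subseteq> span (insert x F)"
      proof
        fix z assume z: "z \<in> S"
        have "z - inner x z *\<^sub>R x \<in> span F"
          using z x xx S by (simp add: F(2) T_def subspace_diff subspace_scale inner_simps)
        then show "z \<in> span (insert x F)" by (auto simp: span_breakdown_eq)
      qed
    qed
    then show ?thesis
      using F FT xx by (intro exI[of _ "insert x F"]) auto
  qed
qed

lemma ex_orthonormal_basis_diagonalizing:
  fixes B :: "'a::euclidean_space \<Rightarrow> 'a \<Rightarrow> real"
  assumes "bilinear B" "\<And>x y. B x y = B y x"
  obtains E where "orthonormal_basis E"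
    "\<And>i j. i < length E \<Longrightarrow> j < length E \<Longrightarrow> i \<noteq> j \<Longrightarrow> B (E ! i) (E ! j) = 0"
proof -
  obtain F where F: "finite F" "span F = UNIV"
      "\<forall>u\<in>F. \<forall>v\<in>F. inner u v = (if u = v then 1 else 0)"
      "\<forall>u\<in>F. \<forall>v\<in>F. u \<noteq> v \<longrightarrow> B u v = 0"
    using ex_orthonormal_diagonalizing_set[OF assms subspace_UNIV] by blast
  obtain E where E: "set E = F" "distinct E" using finite_distinct_list[OF F(1)] by blast
  show thesis
  proof (rule that[of E])
    show "orthonormal_basis E"
      unfolding orthonormal_basis_def using F E by (auto simp: nth_eq_iff_index_eq)
  qed (use F E in \<open>auto simp: nth_eq_iff_index_eq\<close>)
qed

text \<open>In a diagonalizing basis the eigenvalues are the values \<open>d\<^sub>i = B(e\<^sub>i, e\<^sub>i)\<close>. Some \<open>d\<^sub>k\<close> is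
  positive since \<open>B(P, P) > 0\<close>. For \<open>i \<noteq> k\<close> the plane spanned by \<open>e\<^sub>i\<close> and \<open>e\<^sub>k\<close> meets the
  hyperplane orthogonal to \<open>J\<close> in a nonzero vector, and negativity there forces \<open>d\<^sub>i < 0\<close>.\<close>

lemma lorentzian_signature_if_negative_on_hyperplane:
  fixes B :: "'a::euclidean_space \<Rightarrow> 'a \<Rightarrow> real"
  assumes B: "bilinear B" and sym: "\<And>x y. B x y = B y x"
    and pos: "B P P > 0"
    and neg: "\<And>z. inner J z = 0 \<Longrightarrow> z \<noteq> 0 \<Longrightarrow> B z z < 0"
  obtains E where "orthonormal_basis E" "one_positive_eigenvalue (gram_matrix B E)"
    "Determinant.det (gram_matrix B E) \<noteq> 0"
proof -
  obtain E where E: "orthonormal_basis E"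
    and off: "\<And>i j. i < length E \<Longrightarrow> j < length E \<Longrightarrow> i \<noteq> j \<Longrightarrow> B (E ! i) (E ! j) = 0"
    using ex_orthonormal_basis_diagonalizing[OF B sym] by metis
  note B_simps = bilinear_ladd[OF B] bilinear_radd[OF B] bilinear_lmul[OF B] bilinear_rmul[OF B]
    bilinear_lsub[OF B] bilinear_rsub[OF B]
  define N where "N = length E"
  define d where "d i = B (E ! i) (E ! i)" for i
  have on: "inner (E ! i) (E ! j) = (if i = j then 1 else 0)" if "i < N" "j < N" for i j
    using E that by (simp add: orthonormal_basis_def N_def)
  have BPP: "B P P = (\<Sum>i<N. (inner P (E ! i))\<^sup>2 * d i)"
  proof -
    define c where "c i = inner P (E ! i)" for i
    have P: "P = (\<Sum>i<N. c i *\<^sub>R E ! i)"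
      using orthonormal_basis_expansion[OF E, of P] by (simp add: c_def N_def)
    have "B P P = (\<Sum>(i, j)\<in>{..<N} \<times> {..<N}. B (c i *\<^sub>R E ! i) (c j *\<^sub>R E ! j))"
      by (subst (1 2) P) (rule bilinear_sum[OF B])
    also have "\<dots> = (\<Sum>i<N. \<Sum>j<N. if i = j then (c i)\<^sup>2 * d i else 0)"
      unfolding sum.cartesian_product[symmetric]
      by (intro sum.cong refl) (auto simp: B_simps d_def power2_eq_square off N_def)
    finally show ?thesis by (simp add: c_def)
  qed
  have "\<exists>k<N. d k > 0"
  proof (rule ccontr)
    assume "\<not> (\<exists>k<N. d k > 0)"
    then have "d i \<le> 0" if "i < N" for i using that not_le by blast
    then have "B P P \<le> 0"
      unfolding BPP by (intro sum_nonpos mult_nonneg_nonpos) auto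
    with pos show False by simp
  qed
  then obtain k where k: "k < N" "d k > 0" by blast
  have dneg: "d i < 0" if i: "i < N" "i \<noteq> k" for i
  proof -
    define a b where "a = inner J (E ! i)" and "b = inner J (E ! k)"
    have "b \<noteq> 0"
    proof
      assume "b = 0"
      moreover have "E ! k \<noteq> 0" using on[OF k(1) k(1)] by auto
      ultimately have "d k < 0" unfolding d_def b_def by (intro neg)
      with k(2) show False by simp
    qed
    define z where "z = b *\<^sub>R E ! i - a *\<^sub>R E ! k"
    have "inner (E ! i) z = b" using on i k by (simp add: z_def inner_simps)
    with \<open>b \<noteq> 0\<close> have "z \<noteq> 0" by auto
    moreover have "inner J z = 0" by (simp add: z_def a_def b_def inner_simps)
    ultimately have "B z z < 0" by (rule neg[rotated])
    moreover have "B z z = b\<^sup>2 * d i + a\<^sup>2 * d k"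
      using off i k by (simp add: z_def d_def B_simps power2_eq_square N_def)
    moreover have "a\<^sup>2 * d k \<ge> 0" using k by simp
    ultimately have "b\<^sup>2 * d i < 0" by linarith
    then show ?thesis by (simp add: mult_less_0_iff)
  qed
  let ?Q = "gram_matrix B E"
  have Q: "?Q \<in> carrier_mat N N" by (simp add: gram_matrix_def N_def)
  have ut: "upper_triangular ?Q"
    unfolding upper_triangular_def by (auto simp: gram_matrix_def off)
  have diag: "diag_mat ?Q = map d [0..<N]"
    by (simp add: diag_mat_def gram_matrix_def d_def N_def)
  have "Determinant.det ?Q = prod_list (map d [0..<N])"
    using det_upper_triangular[OF ut Q] diag by simp
  moreover have "0 \<notin> set (map d [0..<N])"
    using dneg k(2) by (metis (no_types, lifting) atLeastLessThan_iff imageE less_irrefl list.set_map set_upt)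
  ultimately have det: "Determinant.det ?Q \<noteq> 0" by (simp add: prod_list_zero_iff)
  have "proots (char_poly ?Q) = proots (\<Prod>a\<leftarrow>map d [0..<N]. [:- a, 1:])"
    using char_poly_upper_triangular[OF Q ut] diag by simp
  also have "\<dots> = (\<Sum>a\<leftarrow>map d [0..<N]. {#a#})"
  proof -
    have "0 \<notin> set (map (\<lambda>a. [:- a, 1:]) (map d [0..<N]))" by auto
    from proots_prod_list[OF this] show ?thesis by (simp add: o_def)
  qed
  also have "\<dots> = image_mset d (mset [0..<N])"
    by (induction N) auto
  finally have "size (filter_mset (\<lambda>e. e > 0) (proots (char_poly ?Q))) =
      card {i. i < N \<and> d i > 0}"
    by (simp add: filter_mset_image_mset)
  also have "{i. i < N \<and> d i > 0} = {k}" using k dneg by fastforce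
  finally have "one_positive_eigenvalue ?Q" by (simp add: one_positive_eigenvalue_def)
  with E det show thesis by (intro that)
qed

section \<open>Rank-one matrices and the positive semidefinite cone\<close>

lemma inner_matrix_rank_one: "inner A (rank_one v) = inner v (mat_of A *v v)"
  by (simp add: inner_mat_of inner_vec_def mat_of_rank_one matrix_vector_mult_def sum_distrib_left
      algebra_simps)

lemma psd_cone_iff_inner_rank_one: "A \<in> psd_cone \<longleftrightarrow> (\<forall>v. 0 \<le> inner A (rank_one v))"
  by (simp add: psd_cone_def inner_matrix_rank_one)

lemma inner_rank_one_rank_one: "inner (rank_one x) (rank_one y) = (inner x y)\<^sup>2"
  by (simp add: inner_mat_of inner_vec_def mat_of_rank_one power2_eq_square sum_product
      algebra_simps)

lemma norm_rank_one: "norm (rank_one x) = (norm x)\<^sup>2"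
  by (simp add: norm_eq_sqrt_inner inner_rank_one_rank_one)

lemma rank_one_scaleR: "rank_one (c *\<^sub>R x) = c\<^sup>2 *\<^sub>R rank_one x"
  by (intro symmat_eqI)
    (simp add: Finite_Cartesian_Product.vec_eq_iff mat_of_rank_one power2_eq_square)

lemma rank_one_midpoint:
  "rank_one ((1/2) *\<^sub>R (x + y)) + rank_one ((1/2) *\<^sub>R (x - y)) = (1/2) *\<^sub>R (rank_one x + rank_one y)"
  by (intro symmat_eqI)
    (simp add: Finite_Cartesian_Product.vec_eq_iff mat_of_rank_one field_simps)

definition identity_symmat :: "'n::finite symmat" where
  "identity_symmat = Symmat (Finite_Cartesian_Product.mat 1)"

lemma mat_of_identity: "mat_of (identity_symmat :: 'n::finite symmat) = Finite_Cartesian_Product.mat 1"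
  unfolding identity_symmat_def by (rule mat_of_Symmat) (simp add: Finite_Cartesian_Product.mat_def)

lemma inner_identity_rank_one: "inner identity_symmat (rank_one v) = (norm v)\<^sup>2"
  by (simp add: inner_matrix_rank_one mat_of_identity power2_norm_eq_inner)

lemma inner_identity_identity: "inner identity_symmat (identity_symmat :: 'n::finite symmat) = CARD('n)"
  by (simp add: inner_mat_of mat_of_identity inner_vec_def Finite_Cartesian_Product.mat_def
      if_distrib cong: if_cong)

lemma quadratic_form_shift_axis:
  fixes A :: "'n::finite symmat"
  shows "inner A (rank_one (v + s *\<^sub>R axis i 1)) =
    inner A (rank_one v) + 2 * s * inner (mat_of A $ i) v + s\<^sup>2 * mat_of A $ i $ i"
proof -
  have col: "mat_of A *v axis i 1 = mat_of A $ i"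
    by (simp add: matrix_vector_mul_component Finite_Cartesian_Product.vec_eq_iff inner_axis mat_of_sym[of A i])
  show ?thesis
    by (simp add: inner_matrix_rank_one matrix_vector_right_distrib matrix_vector_mult_scaleR col
        matrix_vector_mul_component
        inner_simps inner_axis' inner_commute[of v] power2_eq_square algebra_simps)
qed

text \<open>Every positive semidefinite matrix is a sum of rank-one matrices, by symmetric Gaussian
  elimination: if \<open>a = A\<^sub>i\<^sub>i > 0\<close> and \<open>r\<close> is row \<open>i\<close>, then \<open>A - rr\<^sup>t/a\<close> is still positive
  semidefinite, and its diagonal keeps all zeros and gets a new one at \<open>i\<close>. A positive semidefinite matrix with
  zero diagonal is zero.\<close>

lemma psd_cone_linear_nonneg:
  fixes f :: "'n::finite symmat \<Rightarrow> real"
  assumes f: "linear f" and unit: "\<And>v. norm v = 1 \<Longrightarrow> 0 \<le> f (rank_one v)"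
  shows "A \<in> psd_cone \<Longrightarrow> 0 \<le> f A"
proof (induction "card {i. mat_of A $ i $ i \<noteq> 0}" arbitrary: A rule: less_induct)
  case less
  have psd: "0 \<le> inner A (rank_one v)" for v
    using less.prems by (simp add: psd_cone_iff_inner_rank_one)
  have axis_form: "inner A (rank_one (axis j 1)) = mat_of A $ j $ j" for j
    using quadratic_form_shift_axis[of A 0 1 j] by (simp add: inner_matrix_rank_one)
  show ?case
  proof (cases "\<forall>i. mat_of A $ i $ i = 0")
    case True
    \<comment> \<open>The form takes the values \<open>2A\<^sub>i\<^sub>j\<close> and \<open>-2A\<^sub>i\<^sub>j\<close> at the sum and the difference of two
      coordinate vectors.\<close>
    have "mat_of A $ i $ j = 0" for i j
      using psd[of "axis j 1 + 1 *\<^sub>R axis i 1"] psd[of "axis j 1 + (-1) *\<^sub>R axis i 1"]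
      unfolding quadratic_form_shift_axis axis_form using True by (simp add: inner_axis)
    then have "A = 0"
      by (intro symmat_eqI) (simp add: Finite_Cartesian_Product.vec_eq_iff)
    then show ?thesis using linear_0[OF f] by simp
  next
    case False
    then obtain i where i: "mat_of A $ i $ i \<noteq> 0" by blast
    define a where "a = mat_of A $ i $ i"
    define r where "r = mat_of A $ i"
    define A' where "A' = A - (1 / a) *\<^sub>R rank_one r"
    have a: "a > 0" using psd[of "axis i 1"] i by (simp add: axis_form a_def)
    have ra: "r $ i = a" by (simp add: r_def a_def)
    \<comment> \<open>The right side is the minimum of the form of \<open>A\<close> on the line through \<open>v\<close> in
      direction \<open>e\<^sub>i\<close>.\<close>
    have gap: "0 \<le> inner A (rank_one v) - (inner r v)\<^sup>2 / a" for v
      using psd[of "v + (- inner r v / a) *\<^sub>R axis i 1"] a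
      unfolding quadratic_form_shift_axis
      by (simp add: r_def[symmetric] ra power2_eq_square field_simps)
    have psd': "A' \<in> psd_cone"
      using gap by (simp add: psd_cone_iff_inner_rank_one A'_def inner_diff_left
          inner_rank_one_rank_one)
    have diag: "mat_of A' $ j $ j = mat_of A $ j $ j - (mat_of A $ i $ j)\<^sup>2 / a" for j
      by (simp add: A'_def mat_of_rank_one r_def power2_eq_square)
    have "mat_of A' $ j $ j = 0" if "mat_of A $ j $ j = 0" for j
    proof -
      have "(mat_of A $ i $ j)\<^sup>2 / a \<le> 0"
        using gap[of "axis j 1"] that by (simp add: axis_form r_def inner_axis)
      then have "(mat_of A $ i $ j)\<^sup>2 \<le> 0" using a by (simp add: divide_le_0_iff)
      then show ?thesis using that by (simp add: diag)
    qed
    moreover have "mat_of A' $ i $ i = 0"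
      using a by (simp add: diag a_def[symmetric] power2_eq_square)
    ultimately have "{j. mat_of A' $ j $ j \<noteq> 0} \<subset> {j. mat_of A $ j $ j \<noteq> 0}"
      using i by auto
    then have "0 \<le> f A'" using psd' by (intro less.hyps psubset_card_mono) simp_all
    moreover have "f A = f A' + (1 / a) * f (rank_one r)"
      by (simp add: A'_def linear_diff[OF f] linear_cmul[OF f])
    moreover have "0 \<le> f (rank_one r)"
    proof -
      have "r \<noteq> 0" using a by (auto simp: r_def a_def)
      then have "rank_one r = (norm r)\<^sup>2 *\<^sub>R rank_one (r /\<^sub>R norm r)"
        by (simp flip: rank_one_scaleR)
      then have "f (rank_one r) = (norm r)\<^sup>2 * f (rank_one (r /\<^sub>R norm r))"
        by (metis linear_cmul[OF f] real_scaleR_def)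
      moreover have "norm (r /\<^sub>R norm r) = 1" using \<open>r \<noteq> 0\<close> by simp
      ultimately show ?thesis using unit by simp
    qed
    ultimately show ?thesis using a by simp
  qed
qed

text \<open>A perturbation of norm less than \<open>e\<close> changes the value of the form at \<open>v\<close> by at most \<open>e|v|\<^sup>2\<close>,
  which is what \<open>eI\<close> contributes.\<close>

lemma psd_cone_add_identity_interior:
  fixes A :: "'n::finite symmat"
  assumes A: "A \<in> psd_cone" and e: "e > 0"
  shows "A + e *\<^sub>R identity_symmat \<in> interior psd_cone"
proof (rule interiorI)
  show "ball (A + e *\<^sub>R identity_symmat) e \<subseteq> psd_cone"
  proof
    fix Y assume "Y \<in> ball (A + e *\<^sub>R identity_symmat) e"
    then have D: "norm (A + e *\<^sub>R identity_symmat - Y) < e" by (simp add: dist_norm)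
    have "0 \<le> inner Y (rank_one v)" for v
    proof -
      have "inner (A + e *\<^sub>R identity_symmat - Y) (rank_one v) \<le> e * (norm v)\<^sup>2"
        using norm_cauchy_schwarz[of "A + e *\<^sub>R identity_symmat - Y" "rank_one v"] D
          mult_right_mono[of "norm (A + e *\<^sub>R identity_symmat - Y)" e "(norm v)\<^sup>2"]
        by (simp add: norm_rank_one)
      moreover have "0 \<le> inner A (rank_one v)" using A by (simp add: psd_cone_iff_inner_rank_one)
      ultimately show ?thesis by (simp add: inner_simps inner_identity_rank_one)
    qed
    then show "Y \<in> psd_cone" by (simp add: psd_cone_iff_inner_rank_one)
  qed
qed (simp_all add: e)

lemma interior_psd_cone_minus_identity:
  fixes A :: "'n::finite symmat"
  assumes "A \<in> interior psd_cone"
  obtains e where "e > 0" "A - e *\<^sub>R identity_symmat \<in> psd_cone"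
proof -
  obtain d where d: "d > 0" "ball A d \<subseteq> psd_cone"
    using assms by (auto simp: mem_interior)
  have n: "norm (identity_symmat :: 'n symmat) > 0"
    using inner_identity_identity[where 'n='n] by fastforce
  define e where "e = d / (2 * norm (identity_symmat :: 'n symmat))"
  have "A - e *\<^sub>R identity_symmat \<in> ball A d"
    using d n by (simp add: e_def dist_norm)
  with d n show thesis by (intro that[of e]) (auto simp: e_def)
qed

section \<open>Quartic forms as restrictions of quadratic forms\<close>

lemma Phi_quadratic_form_quartic:
  fixes B :: "'n::finite symmat \<Rightarrow> 'n symmat \<Rightarrow> real"
  assumes B: "bilinear B"
  shows "quartic_form (\<lambda>x. B (rank_one x) (rank_one x))"
proof -
  \<comment> \<open>The symmetrized matrix units \<open>(e\<^sub>ie\<^sub>j\<^sup>t + e\<^sub>je\<^sub>i\<^sup>t)/2\<close>, obtained by polarizing \<open>xx\<^sup>t\<close>.\<close>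
  define S :: "'n \<times> 'n \<Rightarrow> 'n symmat" where
    "S = (\<lambda>(i, j). (1/2) *\<^sub>R (rank_one (axis i 1 + axis j 1) - rank_one (axis i 1) - rank_one (axis j 1)))"
  have sum_pair: "(\<Sum>p\<in>UNIV. g p) = (\<Sum>i\<in>UNIV. \<Sum>j\<in>UNIV. g (i, j))" for g :: "'n \<times> 'n \<Rightarrow> real"
    by (simp add: sum.cartesian_product)
  define e :: "'n \<Rightarrow> 'n \<Rightarrow> real" where "e k c = (if c = k then 1 else 0)" for k c
  have e: "(\<Sum>i\<in>UNIV. x $ i * e i a) = x $ a" for x a
    by (simp add: e_def if_distrib cong: if_cong)
  have "axis k 1 $ c = e k c" for k c by (simp add: e_def axis_def)
  then have S: "mat_of (S (i, j)) $ a $ b = (e i a * e j b + e i b * e j a) / 2" for i j a b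
    by (simp add: S_def mat_of_rank_one algebra_simps)
  have rank_one: "rank_one x = (\<Sum>p\<in>UNIV. (x $ fst p * x $ snd p) *\<^sub>R S p)" for x
  proof (rule symmat_eqI)
    have mat_of_sum: "mat_of (sum g T) = (\<Sum>p\<in>T. mat_of (g p))" if "finite T"
      for g :: "'n \<times> 'n \<Rightarrow> 'n symmat" and T
      using that by induction auto
    have "(\<Sum>p\<in>UNIV. (x $ fst p * x $ snd p) * mat_of (S p) $ a $ b) = x $ a * x $ b" for a b
    proof -
      have "(\<Sum>p\<in>UNIV. (x $ fst p * x $ snd p) * mat_of (S p) $ a $ b) =
          (\<Sum>i\<in>UNIV. \<Sum>j\<in>UNIV. (x $ i * x $ j) * mat_of (S (i, j)) $ a $ b)"
        by (simp only: sum_pair fst_conv snd_conv)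
      also have "\<dots> = ((\<Sum>i\<in>UNIV. x $ i * e i a) * (\<Sum>j\<in>UNIV. x $ j * e j b) +
          (\<Sum>i\<in>UNIV. x $ i * e i b) * (\<Sum>j\<in>UNIV. x $ j * e j a)) / 2"
        unfolding sum_product sum.distrib[symmetric] sum_divide_distrib
        by (intro sum.cong refl) (simp add: S algebra_simps)
      finally show ?thesis by (simp add: e)
    qed
    then show "mat_of (rank_one x) = mat_of (\<Sum>p\<in>UNIV. (x $ fst p * x $ snd p) *\<^sub>R S p)"
      by (simp add: mat_of_sum Finite_Cartesian_Product.vec_eq_iff mat_of_rank_one sum_component)
  qed
  have "B (rank_one x) (rank_one x) = (\<Sum>i\<in>UNIV. \<Sum>j\<in>UNIV. \<Sum>k\<in>UNIV. \<Sum>l\<in>UNIV.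
      B (S (i, j)) (S (k, l)) * x $ i * x $ j * x $ k * x $ l)" for x
  proof -
    have "B (rank_one x) (rank_one x) = (\<Sum>p\<in>UNIV. \<Sum>r\<in>UNIV.
        B (S p) (S r) * x $ fst p * x $ snd p * x $ fst r * x $ snd r)"
      by (subst (1 2) rank_one)
        (simp only: bilinear_sum[OF B] sum.cartesian_product[symmetric] bilinear_lmul[OF B]
          bilinear_rmul[OF B] real_scaleR_def mult_ac)
    then show ?thesis by (simp only: sum_pair fst_conv snd_conv)
  qed
  then show ?thesis unfolding quartic_form_def by (intro exI[of _ "\<lambda>i j k l. B (S (i, j)) (S (k, l))"]) simp
qed

text \<open>Pairing the first two and the last two variables of each monomial, the coefficients define a
  bilinear form on matrices; symmetrizing it does not change its values on the diagonal.\<close>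

lemma quartic_form_eq_Phi:
  fixes p :: "real^'n::finite \<Rightarrow> real"
  assumes "quartic_form p"
  obtains B :: "'n symmat \<Rightarrow> 'n symmat \<Rightarrow> real"
  where "bilinear B" "\<And>X Y. B X Y = B Y X" "\<And>x. B (rank_one x) (rank_one x) = p x"
proof -
  obtain c where c: "\<And>x. p x = (\<Sum>i\<in>UNIV. \<Sum>j\<in>UNIV. \<Sum>k\<in>UNIV. \<Sum>l\<in>UNIV.
        c i j k l * x $ i * x $ j * x $ k * x $ l)"
    using assms by (auto simp: quartic_form_def)
  define B0 where "B0 X Y = (\<Sum>i\<in>UNIV. \<Sum>j\<in>UNIV. \<Sum>k\<in>UNIV. \<Sum>l\<in>UNIV.
        c i j k l * mat_of X $ i $ j * mat_of Y $ k $ l)" for X Y :: "'n symmat"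
  have add: "B0 (X + X') Y = B0 X Y + B0 X' Y" "B0 Y (X + X') = B0 Y X + B0 Y X'"
    and mul: "B0 (r *\<^sub>R X) Y = r * B0 X Y" "B0 Y (r *\<^sub>R X) = r * B0 Y X" for X X' Y r
    by (simp_all add: B0_def sum.distrib sum_distrib_left algebra_simps)
  define B where "B X Y = (B0 X Y + B0 Y X) / 2" for X Y
  show thesis
  proof (rule that[of B])
    show "bilinear B"
      unfolding bilinear_def
      by (auto intro!: linearI simp: B_def add mul field_simps)
    show "B X Y = B Y X" for X Y by (simp add: B_def)
    show "B (rank_one x) (rank_one x) = p x" for x
      by (simp add: B_def B0_def c mat_of_rank_one mult.assoc)
  qed
qed

section \<open>Lorentzian forms on the semidefinite cone\<close>

text \<open>The positive semidefinite cone is the closure of its interior: \<open>A\<close> is the limit of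
  \<open>A + eI\<close> as \<open>e\<close> tends to zero from above.\<close>

lemma nonneg_on_psd_cone_if_pos_on_interior:
  fixes B :: "'n::finite symmat \<Rightarrow> 'n symmat \<Rightarrow> real"
  assumes B: "bilinear B" and pos: "\<And>X. X \<in> interior psd_cone \<Longrightarrow> B X X > 0"
    and A: "A \<in> psd_cone"
  shows "0 \<le> B A A"
proof -
  let ?I = "identity_symmat :: 'n symmat"
  have "((\<lambda>e. B (A + e *\<^sub>R ?I) (A + e *\<^sub>R ?I)) \<longlongrightarrow> B (A + 0 *\<^sub>R ?I) (A + 0 *\<^sub>R ?I)) (at_right 0)"
    by (rule bounded_bilinear.tendsto[OF B[unfolded bilinear_conv_bounded_bilinear]];
        intro tendsto_intros)
  moreover have "\<forall>\<^sub>F e in at_right (0::real). 0 \<le> B (A + e *\<^sub>R ?I) (A + e *\<^sub>R ?I)"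
    using pos[OF psd_cone_add_identity_interior[OF A]]
    by (intro eventually_at_rightI[of 0 1]) (simp_all add: less_imp_le)
  ultimately have "0 \<le> B (A + 0 *\<^sub>R ?I) (A + 0 *\<^sub>R ?I)"
    by (rule tendsto_lowerbound) simp
  then show ?thesis by simp
qed

text \<open>By linearity in each argument \<open>B\<close> is nonnegative on pairs of positive semidefinite matrices. An
  interior matrix is such a matrix plus a positive multiple of the identity, and the product of the
  two identity parts contributes a positive term.\<close>

lemma pos_on_interior_if_nonneg_on_rank_one:
  fixes B :: "'n::finite symmat \<Rightarrow> 'n symmat \<Rightarrow> real"
  assumes B: "bilinear B"
    and nonneg: "\<And>x y. norm x = 1 \<Longrightarrow> norm y = 1 \<Longrightarrow> 0 \<le> B (rank_one x) (rank_one y)"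
    and I: "B identity_symmat identity_symmat > 0"
    and X: "X \<in> interior psd_cone" and Y: "Y \<in> interior psd_cone"
  shows "B X Y > 0"
proof -
  have lin: "linear (\<lambda>X. B X Y)" "linear (B X)" for X Y using B by (auto simp: bilinear_def)
  have psd: "0 \<le> B X Y" if "X \<in> psd_cone" "Y \<in> psd_cone" for X Y
    by (intro psd_cone_linear_nonneg[OF lin(1) _ that(1)] psd_cone_linear_nonneg[OF lin(2) _ that(2)]
        nonneg)
  obtain d where d: "d > 0" "X - d *\<^sub>R identity_symmat \<in> psd_cone"
    using X by (rule interior_psd_cone_minus_identity)
  obtain e where e: "e > 0" "Y - e *\<^sub>R identity_symmat \<in> psd_cone"
    using Y by (rule interior_psd_cone_minus_identity)
  have I_psd: "identity_symmat \<in> (psd_cone :: 'n symmat set)"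
    by (simp add: psd_cone_iff_inner_rank_one inner_identity_rank_one)
  define X' Y' where "X' = X - d *\<^sub>R identity_symmat" and "Y' = Y - e *\<^sub>R identity_symmat"
  have "B X Y = B (X' + d *\<^sub>R identity_symmat) (Y' + e *\<^sub>R identity_symmat)"
    by (simp add: X'_def Y'_def)
  also have "\<dots> = B X' Y' + e * B X' identity_symmat + d * B identity_symmat Y'
      + d * e * B identity_symmat identity_symmat"
    by (simp add: bilinear_ladd[OF B] bilinear_radd[OF B] bilinear_lmul[OF B] bilinear_rmul[OF B]
        algebra_simps)
  also have "\<dots> > 0"
    using d e I I_psd by (intro add_nonneg_pos add_nonneg_nonneg mult_nonneg_nonneg mult_pos_pos psd)
      (simp_all add: X'_def Y'_def)
  finally show ?thesis .
qed

text \<open>For unit vectors \<open>x\<close>, \<open>y\<close> put \<open>u = (x + y)/2\<close> and \<open>d = (x - y)/2\<close>, which are orthogonal with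
  \<open>4|u|\<^sup>2|d|\<^sup>2 = 1 - \<langle>x, y\<rangle>\<^sup>2\<close>. By polarization \<open>B(xx\<^sup>t, yy\<^sup>t) = q(uu\<^sup>t + dd\<^sup>t) - q((xx\<^sup>t - yy\<^sup>t)/2)\<close>.
  In the first term \<open>q(uu\<^sup>t)\<close> and \<open>q(dd\<^sup>t)\<close> are nonnegative, and the remaining cross term
  \<open>2B(uu\<^sup>t, dd\<^sup>t)\<close> and the second term are both of size \<open>C(1 - \<langle>x, y\<rangle>\<^sup>2)/2\<close> at most.\<close>

lemma rank_one_pair_lower_bound:
  fixes B :: "'n::finite symmat \<Rightarrow> 'n symmat \<Rightarrow> real"
  assumes B: "bilinear B" and sym: "\<And>X Y. B X Y = B Y X"
    and C: "\<And>X Y. \<bar>B X Y\<bar> \<le> C * norm X * norm Y"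
    and nonneg: "\<And>x. 0 \<le> B (rank_one x) (rank_one x)"
    and unit: "norm x = 1" "norm y = 1"
  shows "- C * (1 - (inner x y)\<^sup>2) \<le> B (rank_one x) (rank_one y)"
proof -
  define u d where "u = (1/2) *\<^sub>R (x + y)" and "d = (1/2) *\<^sub>R (x - y)"
  define W where "W = (1/2) *\<^sub>R (rank_one x - rank_one y)"
  have xy: "inner x x = 1" "inner y y = 1" using unit by (simp_all add: norm_eq_1)
  have uu: "inner u u = (1 + inner x y) / 2" and dd: "inner d d = (1 - inner x y) / 2"
    using xy by (simp_all add: u_def d_def inner_simps inner_commute[of y x] field_simps)
  have ud: "norm (rank_one u) * norm (rank_one d) = (1 - (inner x y)\<^sup>2) / 4"
    unfolding norm_rank_one power2_norm_eq_inner uu dd by (simp add: power2_eq_square field_simps)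
  have "inner W W = (1 - (inner x y)\<^sup>2) / 2"
    using xy by (simp add: W_def inner_simps inner_rank_one_rank_one inner_commute[of y x] field_simps)
  then have WW: "norm W * norm W = (1 - (inner x y)\<^sup>2) / 2"
    by (metis power2_norm_eq_inner power2_eq_square)
  have "B (rank_one x) (rank_one y) =
      B ((1/2) *\<^sub>R (rank_one x + rank_one y)) ((1/2) *\<^sub>R (rank_one x + rank_one y)) - B W W"
    by (simp add: W_def bilinear_ladd[OF B] bilinear_radd[OF B] bilinear_lmul[OF B] bilinear_rmul[OF B]
        bilinear_lsub[OF B] bilinear_rsub[OF B] sym[of "rank_one y" "rank_one x"] field_simps)
  also have "(1/2) *\<^sub>R (rank_one x + rank_one y) = rank_one u + rank_one d"
    unfolding u_def d_def by (rule rank_one_midpoint[symmetric])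
  also have "B (rank_one u + rank_one d) (rank_one u + rank_one d) =
      B (rank_one u) (rank_one u) + 2 * B (rank_one u) (rank_one d) + B (rank_one d) (rank_one d)"
    by (simp add: bilinear_ladd[OF B] bilinear_radd[OF B] sym[of "rank_one d" "rank_one u"])
  finally have eq: "B (rank_one x) (rank_one y) = B (rank_one u) (rank_one u)
      + 2 * B (rank_one u) (rank_one d) + B (rank_one d) (rank_one d) - B W W" .
  have "\<bar>B (rank_one u) (rank_one d)\<bar> \<le> C * ((1 - (inner x y)\<^sup>2) / 4)"
    using C[of "rank_one u" "rank_one d"] ud by (simp add: mult.assoc)
  moreover have "\<bar>B W W\<bar> \<le> C * ((1 - (inner x y)\<^sup>2) / 2)"
    using C[of W W] WW by (simp add: mult.assoc)
  ultimately show ?thesis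
    using nonneg[of u] nonneg[of d] unfolding eq by (simp add: field_simps)
qed

text \<open>The form \<open>(tr X)\<^sup>2 - |X|\<^sup>2\<close> vanishes on rank-one matrices, so every multiple of it may be added to a
  form with the prescribed restriction. Since \<open>n \<ge> 2\<close>, the multiple \<open>2C\<close> outweighs a form bounded
  by \<open>C\<close> at the identity, on the traceless hyperplane and on pairs of rank-one matrices.\<close>

lemma nonneg_quartic_is_Phi_nondegenerate_lorentzian:
  fixes p :: "real^'n::finite \<Rightarrow> real"
  assumes n: "CARD('n) \<ge> 2" and p: "p \<in> nonneg_quartics"
  obtains q :: "'n symmat \<Rightarrow> real" where "q \<in> SL2 psd_cone" "nondegenerate q" "Phi q = p"
proof -
  let ?I = "identity_symmat :: 'n symmat"
  obtain B0 :: "'n symmat \<Rightarrow> 'n symmat \<Rightarrow> real" where B0: "bilinear B0"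
    and sym0: "\<And>X Y. B0 X Y = B0 Y X" and B0p: "\<And>x. B0 (rank_one x) (rank_one x) = p x"
    using p quartic_form_eq_Phi[of p] by (auto simp: nonneg_quartics_def)
  obtain C where C: "C > 0" and bound: "\<And>X Y. \<bar>B0 X Y\<bar> \<le> C * norm X * norm Y"
    using bilinear_bounded_pos[OF B0] by auto
  define B where "B X Y = B0 X Y + 2 * C * (inner ?I X * inner ?I Y - inner X Y)" for X Y
  have B: "bilinear B"
    unfolding bilinear_def
    by (auto intro!: linearI simp: B_def bilinear_ladd[OF B0] bilinear_radd[OF B0]
        bilinear_lmul[OF B0] bilinear_rmul[OF B0] inner_simps algebra_simps)
  have sym: "B X Y = B Y X" for X Y by (simp add: B_def sym0[of X Y] inner_commute[of X Y])
  have restrict: "B (rank_one x) (rank_one x) = p x" for x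
    by (simp add: B_def B0p inner_identity_rank_one norm_rank_one dot_square_norm
        power2_eq_square)
  have pos_I: "B ?I ?I > 0"
  proof -
    have nn: "norm ?I * norm ?I = CARD('n)"
      using inner_identity_identity[where 'n='n] by (simp add: dot_square_norm power2_eq_square)
    have "- (C * CARD('n)) \<le> B0 ?I ?I"
      using bound[of ?I ?I] nn by (simp add: mult.assoc)
    \<comment> \<open>At the identity \<open>(tr X)\<^sup>2 - |X|\<^sup>2\<close> equals \<open>n(n - 1)\<close>, and \<open>n \<ge> 2\<close> gives \<open>2(n - 1) > 1\<close>.\<close>
    moreover have "C * CARD('n) * 1 < C * CARD('n) * (2 * (real CARD('n) - 1))"
      using C n by (intro mult_strict_left_mono) auto
    ultimately show ?thesis
      by (simp add: B_def inner_identity_identity algebra_simps)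
  qed
  have neg: "B Z Z < 0" if "inner ?I Z = 0" "Z \<noteq> 0" for Z
  proof -
    have "B0 Z Z \<le> C * (inner Z Z)"
      using bound[of Z Z] by (simp add: mult.assoc dot_square_norm power2_eq_square)
    moreover have "C * inner Z Z > 0" using C that by simp
    ultimately show ?thesis using that by (simp add: B_def)
  qed
  have "0 \<le> B (rank_one x) (rank_one y)" if "norm x = 1" "norm y = 1" for x y
  proof -
    have "- C * (1 - (inner x y)\<^sup>2) \<le> B0 (rank_one x) (rank_one y)"
      using p by (intro rank_one_pair_lower_bound B0 sym0 bound that)
        (simp add: B0p nonneg_quartics_def)
    moreover have "\<bar>inner x y\<bar> \<le> 1" using Cauchy_Schwarz_ineq2[of x y] that by simp
    then have "(inner x y)\<^sup>2 \<le> 1" by (simp add: abs_square_le_1)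
    then have "0 \<le> C * (1 - (inner x y)\<^sup>2)" using C by simp
    ultimately show ?thesis
      using that by (simp add: B_def inner_identity_rank_one inner_rank_one_rank_one algebra_simps)
  qed
  then have pos: "\<forall>X\<in>interior psd_cone. \<forall>Y\<in>interior psd_cone. B X Y > 0"
    using pos_on_interior_if_nonneg_on_rank_one[OF B _ pos_I] by blast
  obtain E where E: "orthonormal_basis E" "one_positive_eigenvalue (gram_matrix B E)"
      "Determinant.det (gram_matrix B E) \<noteq> 0"
    by (rule lorentzian_signature_if_negative_on_hyperplane[OF B sym pos_I neg])
  have polar: "polar_form (\<lambda>X. B X X) B" using B sym by (simp add: polar_form_def)
  show thesis
  proof (rule that[of "\<lambda>X. B X X"])
    show "(\<lambda>X. B X X) \<in> SL2 psd_cone"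
      unfolding SL2_def quadratic_form_def lorentzian_def using polar E pos by blast
    show "nondegenerate (\<lambda>X. B X X)" unfolding nondegenerate_def using polar E by blast
    show "Phi (\<lambda>X. B X X) = p" by (simp add: Phi_def restrict fun_eq_iff)
  qed
qed

theorem theorem3p12:
  assumes "CARD('n::finite) \<ge> 2"
  shows "Phi ` SL2 (psd_cone :: 'n symmat set) = (nonneg_quartics :: (real^'n \<Rightarrow> real) set) \<and>
         Phi ` {q \<in> SL2 (psd_cone :: 'n symmat set). nondegenerate q} =
           (nonneg_quartics :: (real^'n \<Rightarrow> real) set)"
proof -
  have "Phi q \<in> nonneg_quartics" if "q \<in> SL2 psd_cone" for q :: "'n symmat \<Rightarrow> real"
  proof -
    obtain B where "polar_form q B" and pos: "\<forall>X\<in>interior psd_cone. \<forall>Y\<in>interior psd_cone. B X Y > 0"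
      using \<open>q \<in> SL2 psd_cone\<close> by (auto simp: SL2_def lorentzian_def)
    then have B: "bilinear B" and q: "q = (\<lambda>X. B X X)"
      by (auto simp: polar_form_def fun_eq_iff)
    have "0 \<le> q (rank_one x)" for x
      unfolding q using pos
      by (intro nonneg_on_psd_cone_if_pos_on_interior[OF B])
        (simp_all add: psd_cone_iff_inner_rank_one inner_rank_one_rank_one)
    then show ?thesis
      using Phi_quadratic_form_quartic[OF B] by (simp add: nonneg_quartics_def Phi_def q)
  qed
  moreover have "p \<in> Phi ` {q \<in> SL2 (psd_cone :: 'n symmat set). nondegenerate q}"
    if "p \<in> nonneg_quartics" for p :: "real^'n \<Rightarrow> real"
    using nonneg_quartic_is_Phi_nondegenerate_lorentzian[OF assms that] by blast
  ultimately show ?thesis by blast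
qed

end
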